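(* Let $n\ge 1$, let $A_1,\ldots,A_n$ be nonempty finite sets of positive real numbers, and let $B_1,\ldots,B_n$ be infinite discrete sets of positive real numbers. Let \[ \left( (a_{m,1},\ldots, a_{m,n}, b_{m,1},\ldots, b_{m,n}) \right)_{m \in \mathbf{N}} \] be an infinite sequence of pairwise distinct $2n$-tuples in $A_1\times \cdots \times A_n \times B_1\times \cdots \times B_n$; that is, the $m$-th and $m'$-th tuples are equal if and only if $m=m'$. For $m\in\mathbf{N}$ let \[ c_m = \sum_{i=1}^n \frac{a_{m,i}}{b_{m,i}}. \] Then the sequence $(c_m)_{m\in\mathbf{N}}$ contains a strictly decreasing subsequence; that is, there is a strictly increasing sequence of positive integers $(m_j)_{j\ge1}$ with $c_{m_j} > c_{m_{j+1}} > 0$ for all $j\in\mathbf{N}$.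
   Context: $\mathbf{N}=\{1,2,3,\ldots\}$. A set $B$ of real numbers is called discrete if $B\cap X$ is finite for every bounded set $X\subseteq\mathbf{R}$. *)

theory Defs
  imports "HOL-Analysis.Analysis"
begin

text \<open>This is stronger than topological discreteness (\<^const>\<open>discrete\<close>): for instance,
  the set of all \<open>1 / k\<close> with \<open>k\<close> a positive integer is not discrete in the sense used here.\<close>

definition real_discrete :: "real set \<Rightarrow> bool" where
  "real_discrete B \<longleftrightarrow> (\<forall>X. bounded X \<longrightarrow> finite (B \<inter> X))"

end

theory Submission
  imports Defs
begin

text \<open>Pass to an infinite set of indices on which the numerators are constant and every
  denominator is weakly increasing: discreteness and positivity of the denominators rule out
  strict descent.  The sums are then weakly decreasing along this set, and
  strictly so because two distinct tuples with equal numerators differ in some denominator.\<close>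

text \<open>Every real sequence has a monotone subsequence; apply this to \<open>f\<close> along the
  enumeration of \<open>M\<close>. An increasing subsequence is what is wanted, and a decreasing one
  must take some value infinitely often.\<close>

lemma real_discrete_mono_on_infinite_subset:
  fixes f :: "nat \<Rightarrow> real"
  assumes "real_discrete B" "bdd_below B" "infinite M" "f ` M \<subseteq> B"
  shows "\<exists>M'\<subseteq>M. infinite M' \<and> mono_on M' f"
proof -
  define g where "g = enumerate M"
  have g: "strict_mono g" "range g \<subseteq> M"
    using strict_mono_enumerate[OF assms(3)] range_enumerate[OF assms(3)] by (auto simp: g_def)
  obtain h where h: "strict_mono h" "monoseq (\<lambda>k. (f \<circ> g) (h k))"
    using seq_monosub[of "f \<circ> g"] by blast
  define e where "e = g \<circ> h"
  have e: "strict_mono e" "range e \<subseteq> M"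
    using strict_mono_o[OF g(1) h(1)] g(2) by (auto simp: e_def)
  have inf: "infinite (range e)"
    using e(1) by (simp add: strict_mono_imp_inj_on finite_image_iff)
  consider "incseq (f \<circ> e)" | "decseq (f \<circ> e)"
    using h(2) by (auto simp: monoseq_iff e_def comp_def)
  then show ?thesis
  proof cases
    case 1
    \<comment> \<open>Since \<open>e\<close> is strictly increasing, it reflects the order, so
      monotonicity in the position carries over to the indices themselves.\<close>
    have "mono_on (range e) f"
      using 1 e(1) by (auto simp: mono_on_def incseq_def strict_mono_less_eq)
    then show ?thesis
      using inf e(2) by blast
  next
    case 2
    obtain l where l: "\<And>x. x \<in> B \<Longrightarrow> l \<le> x"
      using assms(2) by (auto simp: bdd_below_def)
    \<comment> \<open>The descending values are trapped between a lower bound of \<open>B\<close>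
      and the first value, where \<open>B\<close> has only finitely many points. By pigeonhole,
      \<open>f\<close> is then constant on an infinite set of indices.\<close>
    have "f ` range e \<subseteq> B \<inter> {l..f (e 0)}"
      using 2 e(2) assms(4) l by (fastforce simp: decseq_def)
    moreover have "finite (B \<inter> {l..f (e 0)})"
      using assms(1) bounded_closed_interval unfolding real_discrete_def by blast
    ultimately have "finite (f ` range e)"
      by (rule finite_subset)
    then obtain m where m: "infinite {x \<in> range e. f x = f m}"
      using pigeonhole_infinite[OF inf] by blast
    have "mono_on {x \<in> range e. f x = f m} f"
      by (auto simp: mono_on_def)
    moreover have "{x \<in> range e. f x = f m} \<subseteq> M"
      using e(2) by blast
    ultimately show ?thesis
      using m by blast
  qed
qed

text \<open>The index set is thinned out once for each coordinate; monotonicity already achieved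
  survives passing to a subset. Working with infinite sets instead of subsequences avoids composing
  index maps.\<close>

lemma real_discrete_mono_on_infinite_subset_family:
  fixes f :: "nat \<Rightarrow> 'i \<Rightarrow> real"
  assumes "finite I" "infinite M"
    and "\<And>i. i \<in> I \<Longrightarrow> real_discrete (B i) \<and> bdd_below (B i)"
    and "\<And>m i. m \<in> M \<Longrightarrow> i \<in> I \<Longrightarrow> f m i \<in> B i"
  shows "\<exists>M'\<subseteq>M. infinite M' \<and> (\<forall>i\<in>I. mono_on M' (\<lambda>m. f m i))"
  using assms(1,3,4)
proof (induction I rule: finite_induct)
  case empty
  then show ?case using assms(2) by auto
next
  case (insert i I)
  then obtain M1 where M1: "M1 \<subseteq> M" "infinite M1" "\<forall>i\<in>I. mono_on M1 (\<lambda>m. f m i)"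
    by auto
  have "(\<lambda>m. f m i) ` M1 \<subseteq> B i"
    using M1(1) insert.prems(2) by blast
  then obtain M2 where M2: "M2 \<subseteq> M1" "infinite M2" "mono_on M2 (\<lambda>m. f m i)"
    using real_discrete_mono_on_infinite_subset[of "B i" M1 "\<lambda>m. f m i"] M1(2) insert.prems(1)
    by auto
  then show ?case
    using M1 by (intro exI[of _ M2]) (auto intro: mono_on_subset)
qed

theorem theorem1:
  fixes n :: nat
    and A B :: "nat \<Rightarrow> real set"
    and a b :: "nat \<Rightarrow> nat \<Rightarrow> real"
    and c :: "nat \<Rightarrow> real"
  assumes "n \<ge> 1"
    and "\<And>i. i \<in> {1..n} \<Longrightarrow> A i \<noteq> {} \<and> finite (A i) \<and> A i \<subseteq> {0<..}"
    and "\<And>i. i \<in> {1..n} \<Longrightarrow> infinite (B i) \<and> real_discrete (B i) \<and> B i \<subseteq> {0<..}"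
    and "\<And>m. m \<ge> 1 \<Longrightarrow> (a m, b m) \<in> (\<Pi>\<^sub>E i\<in>{1..n}. A i) \<times> (\<Pi>\<^sub>E i\<in>{1..n}. B i)"
    and "inj_on (\<lambda>m. (a m, b m)) {1..}"
    and "\<And>m. m \<ge> 1 \<Longrightarrow> c m = (\<Sum>i=1..n. a m i / b m i)"
  shows "\<exists>s :: nat \<Rightarrow> nat. strict_mono_on {1..} s \<and>
           (\<forall>j\<ge>1. s j \<ge> 1 \<and> c (s j) > c (s (j + 1)) \<and> c (s (j + 1)) > 0)"
proof -
  let ?I = "{1..n}"
  have A: "a m i > 0" "a m i \<in> A i" and B: "b m i > 0" "b m i \<in> B i"
    if "m \<ge> 1" "i \<in> ?I" for m i
    using assms(2,3)[OF that(2)] assms(4)[OF that(1)] that(2) by (auto dest!: PiE_mem)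
  have bdd: "bdd_below (B i)" if "i \<in> ?I" for i
    using assms(3)[OF that] by (intro bdd_belowI[of _ 0]) auto
  have "a ` {1..} \<subseteq> (\<Pi>\<^sub>E i\<in>?I. A i)"
    using assms(4) by blast
  moreover have "finite (\<Pi>\<^sub>E i\<in>?I. A i)"
    by (rule finite_PiE) (use assms(2) in auto)
  ultimately have "finite (a ` {1..})"
    by (rule finite_subset)
  \<comment> \<open>Only finitely many numerator tuples exist, so one of them, \<open>a m0\<close>,
    recurs infinitely often.\<close>
  then obtain m0 where m0: "infinite {m \<in> {1..}. a m = a m0}"
    using pigeonhole_infinite[of "{1::nat..}" a] infinite_Ici by blast
  obtain M where M: "M \<subseteq> {m \<in> {1..}. a m = a m0}" "infinite M"
    and mono: "\<forall>i\<in>?I. mono_on M (\<lambda>m. b m i)"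
    using real_discrete_mono_on_infinite_subset_family[OF _ m0, of ?I B b] assms(3) bdd B(2)
    by auto
  have decr: "c m' < c m" if "m \<in> M" "m' \<in> M" "m < m'" for m m'
  proof -
    have m: "m \<ge> 1" "m' \<ge> 1" "a m' = a m"
      using subsetD[OF M(1) that(1)] subsetD[OF M(1) that(2)] by auto
    have le: "b m i \<le> b m' i" if "i \<in> ?I" for i
      using mono that \<open>m \<in> M\<close> \<open>m' \<in> M\<close> \<open>m < m'\<close> by (auto simp: mono_on_def)
    have "b m \<noteq> b m'"
      using inj_onD[OF assms(5), of m m'] m \<open>m < m'\<close> by auto
    \<comment> \<open>Both tuples are extensional, hence agree outside \<open>?I\<close>, so they
      must differ at an index inside it.\<close>
    then obtain i where i: "i \<in> ?I" "b m i \<noteq> b m' i"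
      using assms(4)[OF m(1)] assms(4)[OF m(2)] PiE_ext[of "b m" ?I B "b m'"] by auto
    have "(\<Sum>i=1..n. a m' i / b m' i) < (\<Sum>i=1..n. a m i / b m i)"
    proof (rule sum_strict_mono_ex1)
      show "\<forall>i\<in>?I. a m' i / b m' i \<le> a m i / b m i"
        using A(1) B(1) le m by (auto intro!: divide_left_mono simp: less_imp_le)
      have "a m' i / b m' i < a m i / b m i"
        using A(1)[OF m(1) i(1)] B(1)[OF m(1) i(1)] B(1)[OF m(2) i(1)] le[OF i(1)] i(2) m(3)
        by (auto intro!: divide_strict_left_mono)
      then show "\<exists>i\<in>?I. a m' i / b m' i < a m i / b m i"
        using i(1) by blast
    qed simp
    then show ?thesis
      using assms(6) m by simp
  qed
  \<comment> \<open>The hypothesis \<open>n \<ge> 1\<close> makes the sum nonempty, so positive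
    terms give a positive sum.\<close>
  have pos: "c m > 0" if "m \<ge> 1" for m
    using assms(1) A(1)[OF that] B(1)[OF that]
    by (auto simp: assms(6)[OF that] intro!: sum_pos)
  \<comment> \<open>The enumeration starts at 0 while the required sequence starts at 1; the least
    element of \<open>M\<close> is simply skipped.\<close>
  let ?s = "enumerate M"
  have s: "strict_mono ?s" "?s j \<in> M" for j
    using strict_mono_enumerate[OF M(2)] enumerate_in_set[OF M(2)] by auto
  have ge: "?s j \<ge> 1" for j
    using s(2)[of j] M(1) by auto
  show ?thesis
    using s ge decr pos
    by (intro exI[of _ ?s]) (auto simp: strict_mono_def strict_mono_on_def)
qed

end
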